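(* Consider the following inequality, for constants $c_1,c_2>0$, required to hold for every bounded interval $I_0\subset\mathbb{R}$, every $f\in\mathrm{BLO}(I_0)$ and every $\lambda>0$: $$(\ast)\qquad \sup_{I\subseteq I_0}\frac1{|I|}\left|\left\{x\in I: f(x)-\operatorname*{ess\,inf}_{I} f>\lambda\right\}\right|\le c_1\,e^{-c_2\lambda/\|f\|_{\mathrm{BLO}(I_0)}} .$$ Let $c_2^*$ be the supremum of all $c_2>0$ for which $(\ast)$ holds with some finite $c_1$, and let $c_1^*$ be the smallest constant $c_1$ for which $(\ast)$ holds with $c_2=c_2^*$. Then $$c_1^*=e,\qquad c_2^*=1 .$$ In particular, for every bounded interval $I_0$, every $f\in\mathrm{BLO}(I_0)$, every subinterval $I\subseteq I_0$, and every $\lambda>0$, $$\frac1{|I|}\left|\left\{x\in I: f(x)-\operatorname*{ess\,inf}_I f>\lambda\right\}\right|\le\min\left\{1,\exp\left(1-\frac{\lambda}{\|f\|_{\mathrm{BLO}(I_0)}}\right)\right\},$$ and both constants (the prefactor $e$ and the exponential rate $1$) are sharp in the sense above.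
   Context: Intervals have positive finite length, and $|E|$ denotes Lebesgue measure. For an interval $I$, $f_I=\frac1{|I|}\int_I f(x)\,dx$. For a bounded interval $I_0$ and a real-valued $f\in L^1(I_0)$, $$\|f\|_{\mathrm{BLO}(I_0)}=\sup_{I\subseteq I_0}\left(f_I-\operatorname*{ess\,inf}_I f\right),$$ the supremum being over all subintervals $I$ of $I_0$; $f\in\mathrm{BLO}(I_0)$ means that this quantity is finite. When $\|f\|_{\mathrm{BLO}(I_0)}=0$, the exponentials $e^{-c_2\lambda/\|f\|_{\mathrm{BLO}(I_0)}}$ and $\exp(1-\lambda/\|f\|_{\mathrm{BLO}(I_0)})$ are interpreted as $0$. *)

theory Defs
  imports "HOL-Probability.Essential_Supremum"
begin

text \<open>Intervals may or may not contain their endpoints, but are bounded and of positive length.\<close>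

definition proper_interval :: "real set \<Rightarrow> bool" where
  "proper_interval I \<longleftrightarrow> is_interval I \<and> bounded I \<and> 0 < measure lebesgue I"

definition subintervals :: "real set \<Rightarrow> real set set" where
  "subintervals I0 = {I. proper_interval I \<and> I \<subseteq> I0}"

definition avg :: "real set \<Rightarrow> (real \<Rightarrow> real) \<Rightarrow> real" where
  "avg I f = (1 / measure lebesgue I) * (LINT x:I|lebesgue. f x)"

text \<open>Extended-real valued, since an integrable function may have essential infimum
  \<open>-\<infinity>\<close> on an interval.\<close>

definition essinf :: "real set \<Rightarrow> (real \<Rightarrow> real) \<Rightarrow> ereal" where
  "essinf I f = - esssup (lebesgue_on I) (\<lambda>x. - ereal (f x))"

definition BLO_norm :: "real set \<Rightarrow> (real \<Rightarrow> real) \<Rightarrow> ereal" where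
  "BLO_norm I0 f = (SUP I \<in> subintervals I0. ereal (avg I f) - essinf I f)"

text \<open>A function on \<open>I0\<close> is represented by a total function, whose values outside \<open>I0\<close>
  play no role.\<close>

definition BLO :: "real set \<Rightarrow> (real \<Rightarrow> real) set" where
  "BLO I0 = {f. set_integrable lebesgue I0 f \<and> BLO_norm I0 f < \<infinity>}"

definition upper_fraction :: "real set \<Rightarrow> (real \<Rightarrow> real) \<Rightarrow> real \<Rightarrow> real" where
  "upper_fraction I f l =
     (1 / measure lebesgue I) * measure lebesgue {x \<in> I. ereal (f x) - essinf I f > ereal l}"

text \<open>The exponential \<open>exp (a - b / \<parallel>f\<parallel>)\<close>, read as \<open>0\<close> when the norm \<open>\<parallel>f\<parallel>\<close> vanishes.
  It is only used for \<open>f\<close> in \<open>BLO I0\<close>, where the norm is finite.\<close>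

definition BLO_exp :: "real set \<Rightarrow> (real \<Rightarrow> real) \<Rightarrow> real \<Rightarrow> real \<Rightarrow> real" where
  "BLO_exp I0 f a b =
     (if BLO_norm I0 f = 0 then 0 else exp (a - b / real_of_ereal (BLO_norm I0 f)))"

text \<open>The real supremum below is over a nonempty set of numbers in \<open>[0, 1]\<close>.\<close>

definition John_Nirenberg :: "real \<Rightarrow> real \<Rightarrow> bool" where
  "John_Nirenberg c1 c2 \<longleftrightarrow>
     (\<forall>I0 f l. proper_interval I0 \<longrightarrow> f \<in> BLO I0 \<longrightarrow> 0 < l \<longrightarrow>
        (SUP I \<in> subintervals I0. upper_fraction I f l) \<le> c1 * BLO_exp I0 f 0 (c2 * l))"

text \<open>The supremum is taken in the extended reals, so that its being finite implies that the
  admissible rates are bounded above.\<close>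

definition c2_star :: ereal where
  "c2_star = Sup (ereal ` {c2. 0 < c2 \<and> (\<exists>c1>0. John_Nirenberg c1 c2)})"

text \<open>The smallest constant is a relation, so that its existence is part of any claim
  about its value.\<close>

definition is_c1_star :: "real \<Rightarrow> bool" where
  "is_c1_star c \<longleftrightarrow>
     (0 < c \<and> John_Nirenberg c (real_of_ereal c2_star)) \<and>
     (\<forall>c1>0. John_Nirenberg c1 (real_of_ereal c2_star) \<longrightarrow> c \<le> c1)"

end

theory Submission
  imports Defs
begin

text \<open>
  Let \<open>f\<close> have norm at most \<open>N\<close>, let \<open>m\<close> be its essential infimum on an interval \<open>I\<close>, and write
  \<open>E r\<close> for the part of \<open>I\<close> where \<open>f > r\<close>. The upper bound rests on one estimate: for \<open>r \<ge> m\<close>, the mean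
  of \<open>f\<close> over \<open>E r\<close> is at most \<open>r + N\<close> (\<open>level_set_integral_le\<close>). This is the defining inequality of
  BLO with intervals replaced by level sets. To pass from intervals to level sets, take \<open>s > r + N\<close>.
  Any interval where the mean of \<open>f\<close> is at least \<open>s\<close> has essential infimum larger than \<open>r\<close>, and therefore
  lies in \<open>E r\<close> up to a null set. Approximate \<open>E r\<close> from outside by an open set and add all these
  intervals: the measure does not grow beyond a null set, and on each component of the new set the mean
  is at most \<open>s\<close>, since otherwise the component could be enlarged by an interval of the same kind
  (\<open>open_saturation\<close>, \<open>set_integral_nonpos_of_saturated\<close>). The approximation can be made arbitrarily
  good, so the mean over \<open>E r\<close> is at most \<open>s\<close> too.

  With \<open>\<phi> r\<close> the integral of \<open>f - r\<close> over \<open>E r\<close>, whose derivative is minus the measure of \<open>E r\<close>, the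
  estimate becomes the differential inequality \<open>\<phi> \<le> - N \<phi>'\<close>. It gives
  \<open>\<phi> (m + l) \<le> N \<bar>I\<bar> exp (- l / N)\<close>, and since \<open>f - (r - N) > N\<close> on \<open>E r\<close>, also
  \<open>N \<bar>E r\<bar> \<le> \<phi> (r - N)\<close>. Together these bound \<open>\<bar>E (m + l)\<bar>\<close> by \<open>\<bar>I\<bar> exp (1 - l / N)\<close> for \<open>l \<ge> N\<close>; for
  smaller \<open>l\<close> the bound exceeds \<open>\<bar>I\<bar>\<close> (\<open>level_set_exponential_decay\<close>).

  Both constants are attained in the limit on one family of functions on \<open>(0, 1)\<close>, namely \<open>- ln x\<close>
  with its values on \<open>(0, t)\<close> replaced by their mean \<open>1 - ln t\<close>. The norm of such a function is at most
  \<open>1\<close>, its essential infimum is \<open>0\<close>, and it exceeds every level \<open>l < 1 - ln t\<close> on a set of measure at least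
  \<open>t = exp (1 - (1 - ln t))\<close> (\<open>John_Nirenberg_lower_bound\<close>).
\<close>

section \<open>Integrals over saturated sets\<close>

lemma open_interval_eqI:
  fixes K :: "real set"
  assumes "open K" "connected K" "K \<noteq> {}" "bounded K"
  obtains c d where "c < d" "K = {c<..<d}"
proof -
  have bd: "bdd_below K" "bdd_above K"
    using assms(4) bounded_imp_bdd_below bounded_imp_bdd_above by auto
  have "K = {Inf K<..<Sup K}"
  proof (intro equalityI subsetI)
    fix x assume x: "x \<in> K"
    then obtain e where e: "e > 0" "cball x e \<subseteq> K"
      using assms(1) open_contains_cball by metis
    have "x - e \<in> K" "x + e \<in> K" using e by (auto simp: cball_def dist_real_def subset_iff)
    then have "Inf K \<le> x - e" "x + e \<le> Sup K" using bd by (auto intro: cInf_lower cSup_upper)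
    then show "x \<in> {Inf K<..<Sup K}" using e by auto
  next
    fix x assume x: "x \<in> {Inf K<..<Sup K}"
    then obtain u v where "u \<in> K" "u < x" "v \<in> K" "x < v"
      using assms(3) bd by (auto simp: cInf_less_iff less_cSup_iff)
    then show "x \<in> K" using assms(2) connectedD_interval[of K u v x] by auto
  qed
  moreover from this have "Inf K < Sup K" using assms(3) by (metis greaterThanLessThan_empty not_le)
  ultimately show thesis using that by blast
qed

lemma set_integral_open_subinterval:
  fixes h :: "real \<Rightarrow> real"
  assumes "set_integrable lebesgue {a<..<b} h" "a \<le> c" "c \<le> d" "d \<le> b"
  shows "(LINT x:{c<..<d}|lebesgue. h x) = integral {a..d} h - integral {a..c} h"
proof -
  have "set_integrable lebesgue {c<..<d} h"
    using assms by (intro set_integrable_subset[OF assms(1)]) auto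
  then have 1: "(LINT x:{c<..<d}|lebesgue. h x) = integral {c..d} h"
    by (simp add: set_lebesgue_integral_eq_integral integral_open_interval_real)
  have "h integrable_on {a<..<b}" using assms(1) set_lebesgue_integral_eq_integral(1) by blast
  then have "h integrable_on {a..b}" using integrable_on_open_interval_real by blast
  then have "h integrable_on {a..d}" using assms by (auto intro: integrable_subinterval_real)
  then have "integral {a..c} h + integral {c..d} h = integral {a..d} h"
    using assms by (intro Henstock_Kurzweil_Integration.integral_combine) auto
  with 1 show ?thesis by simp
qed

text \<open>The components of an open set are countably many disjoint open sets. Listing them as \<open>A 0\<close>, \<open>A 1\<close>, and
  so on, the integral over \<open>U\<close> is the limit of the integrals over the first \<open>n\<close> of them.\<close>

lemma set_integral_open_nonpos:
  fixes h :: "real \<Rightarrow> real" and U :: "real set"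
  assumes "open U" "set_integrable lebesgue U h"
    and le: "\<And>K. K \<in> components U \<Longrightarrow> (LINT x:K|lebesgue. h x) \<le> 0"
  shows "(LINT x:U|lebesgue. h x) \<le> 0"
proof -
  define C where "C = components U"
  \<comment> \<open>The union has at most one member, so \<open>A n\<close> is a component or empty; the empty terms
    let finite and infinite families of components be treated alike.\<close>
  define A where "A n = \<Union>{K \<in> C. to_nat_on C K = n}" for n
  have cnt: "countable C" unfolding C_def
  proof (rule countable_disjoint_open_subsets)
    show "open K" if "K \<in> components U" for K
      using that assms(1) open_components by blast
    show "pairwise disjnt (components U)"
      unfolding pairwise_def disjnt_def using components_nonoverlap[of _ U] by metis
  qed
  have opn: "open K" if "K \<in> C" for K
    using that assms(1) open_components unfolding C_def by blast
  have A: "A n = {} \<or> A n \<in> C" for n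
  proof (cases "\<exists>K\<in>C. to_nat_on C K = n")
    case True
    then obtain K where "K \<in> C" "to_nat_on C K = n" by blast
    then have "{K \<in> C. to_nat_on C K = n} = {K}"
      using cnt by (auto dest: inj_onD[OF inj_on_to_nat_on])
    then show ?thesis using \<open>K \<in> C\<close> by (auto simp: A_def)
  qed (auto simp: A_def)
  have UA: "U = (\<Union>n. A n)"
  proof -
    have "(\<Union>n. A n) = \<Union>C" by (auto simp: A_def)
    then show ?thesis by (simp add: C_def)
  qed
  have disj: "A i \<inter> A j = {}" if "i \<noteq> j" for i j
  proof -
    have "K \<inter> L = {}" if "K \<in> C" "to_nat_on C K = i" "L \<in> C" "to_nat_on C L = j" for K L
      using that \<open>i \<noteq> j\<close> components_nonoverlap[of K U L] by (auto simp: C_def)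
    then show ?thesis by (auto simp: A_def)
  qed
  have meas: "A i \<in> sets lebesgue" for i using A[of i] opn by auto
  have int: "set_integrable lebesgue (A i) h" for i
    using meas UA by (intro set_integrable_subset[OF assms(2)]) auto
  have part: "(LINT x:(\<Union>i<n. A i)|lebesgue. h x) \<le> 0" for n
  proof -
    have "(LINT x:(\<Union>i<n. A i)|lebesgue. h x) = (\<Sum>i<n. LINT x:A i|lebesgue. h x)"
      using meas int disj by (intro set_integral_finite_Union) (auto simp: disjoint_family_on_def)
    also have "\<dots> \<le> 0"
    proof (rule sum_nonpos)
      show "(LINT x:A i|lebesgue. h x) \<le> 0" for i
        using A[of i]
      proof
        assume "A i = {}" then show ?thesis by (simp add: set_lebesgue_integral_def)
      next
        assume "A i \<in> C" then show ?thesis using le by (simp add: C_def)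
      qed
    qed
    finally show ?thesis .
  qed
  have eq: "(\<Union>n. \<Union>i<n. A i) = U" unfolding UA by auto
  have "(\<lambda>n. LINT x:(\<Union>i<n. A i)|lebesgue. h x) \<longlonglongrightarrow> (LINT x:(\<Union>n. \<Union>i<n. A i)|lebesgue. h x)"
    using meas assms(2) by (intro set_integral_cont_up) (auto simp: incseq_def eq intro: less_le_trans)
  then show ?thesis
    unfolding eq by (rule LIMSEQ_le_const2) (use part in auto)
qed

text \<open>Adding to \<open>T\<close> every interval on which \<open>h\<close> has a nonnegative integral costs only a null set
  outside \<open>E\<close>, because countably many of these intervals have the same union. The resulting \<open>U\<close>
  cannot have a component \<open>K\<close> with positive integral: since the integral over all of \<open>(a, b)\<close> is
  negative, the intermediate value theorem would enlarge \<open>K\<close> to an interval with nonnegative integral,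
  which would again lie in \<open>U\<close>.\<close>

lemma open_saturation:
  fixes h :: "real \<Rightarrow> real" and E T :: "real set" and a b :: real
  assumes h: "set_integrable lebesgue {a<..<b} h"
    and neg: "(LINT x:{a<..<b}|lebesgue. h x) < 0"
    and sat: "\<And>c d. a \<le> c \<Longrightarrow> c < d \<Longrightarrow> d \<le> b \<Longrightarrow> 0 \<le> (LINT x:{c<..<d}|lebesgue. h x) \<Longrightarrow>
                AE x in lebesgue. x \<in> {c<..<d} \<longrightarrow> x \<in> E"
    and T: "open T" "T \<subseteq> {a<..<b}"
  obtains U where "open U" "T \<subseteq> U" "U \<subseteq> {a<..<b}"
    "AE x in lebesgue. x \<in> U \<longrightarrow> x \<in> T \<or> x \<in> E"
    "(LINT x:U|lebesgue. h x) \<le> 0"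
proof -
  define F where "F = {{c<..<d} |c d. a \<le> c \<and> c < d \<and> d \<le> b \<and> 0 \<le> (LINT x:{c<..<d}|lebesgue. h x)}"
  define U where "U = T \<union> \<Union>F"
  have opF: "open S" if "S \<in> F" for S using that by (auto simp: F_def)
  have "open U" using T opF by (auto simp: U_def)
  have sub: "U \<subseteq> {a<..<b}" using T by (auto simp: U_def F_def)
  obtain F' where F': "F' \<subseteq> F" "countable F'" "\<Union>F' = \<Union>F"
    using Lindelof[of F] opF by blast
  have "AE x in lebesgue. \<forall>S\<in>F'. x \<in> S \<longrightarrow> x \<in> E"
    using F' sat by (intro AE_ball_countable') (auto simp: F_def)
  then have ae: "AE x in lebesgue. x \<in> U \<longrightarrow> x \<in> T \<or> x \<in> E"
  proof eventually_elim
    case (elim x)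
    then show ?case using F'(3) unfolding U_def by blast
  qed
  define H where "H = (\<lambda>x. integral {a..x} h)"
  have H: "(LINT x:{c<..<d}|lebesgue. h x) = H d - H c" if "a \<le> c" "c \<le> d" "d \<le> b" for c d
    unfolding H_def using set_integral_open_subinterval[OF h that] .
  have "h integrable_on {a..b}"
    using set_lebesgue_integral_eq_integral(1)[OF h] integrable_on_open_interval_real by blast
  then have cont: "continuous_on {a..b} H"
    unfolding H_def by (rule indefinite_integral_continuous_1)
  have comp: "(LINT x:K|lebesgue. h x) \<le> 0" if K: "K \<in> components U" for K
  proof (rule ccontr)
    assume "\<not> ?thesis"
    then have pos: "0 < (LINT x:K|lebesgue. h x)" by simp
    have KU: "K \<subseteq> U" using K in_components_subset by blast
    have "bounded K" using KU sub by (intro bounded_subset[OF bounded_closed_interval[of a b]]) auto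
    with open_components[OF \<open>open U\<close> K] in_components_connected[OF K] in_components_nonempty[OF K]
    obtain c d where cd: "c < d" "K = {c<..<d}" by (rule open_interval_eqI)
    have "{c<..<d} \<subseteq> {a<..<b}" using cd KU sub by auto
    then have le: "a \<le> c" "d \<le> b" using cd(1) by (auto simp: greaterThanLessThan_subseteq_greaterThanLessThan)
    have gt: "H d > H c" using pos H[of c d] cd le by auto
    have lt: "H b < H a" using neg H[of a b] cd le by auto
    \<comment> \<open>A strictly larger interval with nonnegative integral is in \<open>F\<close>, hence in \<open>U\<close>, and this
      contradicts the maximality of the component \<open>K\<close>.\<close>
    have max: "c' = c \<and> d' = d" if "a \<le> c'" "c' \<le> c" "d \<le> d'" "d' \<le> b" "H c' \<le> H d'" for c' d'
    proof -
      have "{c'<..<d'} \<in> F" unfolding F_def using that cd H[of c' d']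
        by (intro CollectI exI[of _ c'] exI[of _ d']) auto
      then have "{c'<..<d'} \<subseteq> U" by (auto simp: U_def)
      moreover have "K \<inter> {c'<..<d'} \<noteq> {}" using cd that by auto
      ultimately have "{c'<..<d'} \<subseteq> {c<..<d}"
        using components_maximal[OF K, of "{c'<..<d'}"] cd by auto
      then show ?thesis using that cd by (auto simp: greaterThanLessThan_subseteq_greaterThanLessThan)
    qed
    \<comment> \<open>If \<open>a < c\<close>, then \<open>K\<close> can be extended to the left: either up to \<open>a\<close>, or up to a point where \<open>H\<close>
      takes the value \<open>H d\<close>. If \<open>c = a\<close>, it can be extended to the right, as \<open>H b < H a\<close>.\<close>
    show False
    proof (cases "a < c")
      case True
      have "continuous_on {a..c} H" using cont by (rule continuous_on_subset) (use le cd in auto)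
      moreover have "H a > H d" using max[of a d] le cd True by fastforce
      ultimately obtain z where z: "a \<le> z" "z \<le> c" "H z = H d"
        using IVT2'[of H c "H d" a] gt True by auto
      then show False using max[of z d] le gt by auto
    next
      case False
      then have "c = a" using le by simp
      have "continuous_on {d..b} H" using cont by (rule continuous_on_subset) (use le cd in auto)
      then obtain z where z: "d \<le> z" "z \<le> b" "H z = H c"
        using IVT2'[of H b "H c" d] gt lt \<open>c = a\<close> le by auto
      then show False using max[of c z] le gt by auto
    qed
  qed
  have "set_integrable lebesgue U h"
    using \<open>open U\<close> sub by (intro set_integrable_subset[OF h]) auto
  from set_integral_open_nonpos[OF \<open>open U\<close> this comp]
  have "(LINT x:U|lebesgue. h x) \<le> 0" .
  then show thesis using that[OF \<open>open U\<close> _ sub ae] by (auto simp: U_def)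
qed

text \<open>This takes the place of the rising sun lemma in the usual treatment by rearrangements: instead of
  describing the set where \<open>h\<close> can be large, it works directly with a set \<open>E\<close> that contains, up to null
  sets, every interval on which \<open>h\<close> has a nonnegative integral. Outer regularity and saturation give open
  sets \<open>U n \<supseteq> E\<close>, with \<open>U n - E\<close> of small measure, over which the integral is nonpositive. If these
  measures are chosen summable, the Borel--Cantelli lemma gives almost everywhere convergence of the indicators,
  and the inequality passes to the limit.\<close>

lemma set_integral_nonpos_of_saturated:
  fixes h :: "real \<Rightarrow> real" and E :: "real set" and a b :: real
  assumes h: "set_integrable lebesgue {a<..<b} h"
    and E: "E \<in> sets lebesgue" "E \<subseteq> {a<..<b}"
    and neg: "(LINT x:{a<..<b}|lebesgue. h x) < 0"
    and sat: "\<And>c d. a \<le> c \<Longrightarrow> c < d \<Longrightarrow> d \<le> b \<Longrightarrow> 0 \<le> (LINT x:{c<..<d}|lebesgue. h x) \<Longrightarrow>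
                AE x in lebesgue. x \<in> {c<..<d} \<longrightarrow> x \<in> E"
  shows "(LINT x:E|lebesgue. h x) \<le> 0"
proof -
  have "\<exists>U. open U \<and> E \<subseteq> U \<and> U \<subseteq> {a<..<b} \<and> (LINT x:U|lebesgue. h x) \<le> 0 \<and>
      emeasure lebesgue (U - E) < ennreal ((1/2)^n)" for n :: nat
  proof -
    obtain T where T: "open T" "E \<subseteq> T" "T - E \<in> lmeasurable" "emeasure lebesgue (T - E) < ennreal ((1/2)^n)"
      using sets_lebesgue_outer_open[OF E(1), of "(1/2)^n"] by auto
    obtain U where U: "open U" "T \<inter> {a<..<b} \<subseteq> U" "U \<subseteq> {a<..<b}"
      "AE x in lebesgue. x \<in> U \<longrightarrow> x \<in> T \<inter> {a<..<b} \<or> x \<in> E" "(LINT x:U|lebesgue. h x) \<le> 0"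
      using open_saturation[OF h neg sat, of "T \<inter> {a<..<b}"] T by (auto simp: open_Int)
    have "emeasure lebesgue (U - E) \<le> emeasure lebesgue (T - E)"
      using U(4) T(3) by (intro emeasure_mono_AE) auto
    then show ?thesis using U T E(2) by (intro exI[of _ U]) auto
  qed
  then obtain U where U: "\<And>n::nat. open (U n)" "\<And>n. E \<subseteq> U n" "\<And>n. U n \<subseteq> {a<..<b}"
      "\<And>n. (LINT x:U n|lebesgue. h x) \<le> 0" "\<And>n. emeasure lebesgue (U n - E) < ennreal ((1/2)^n)"
    by metis
  have [measurable]: "U n \<in> sets lebesgue" for n using U(1) by auto
  note E(1)[measurable]
  have "AE x in lebesgue. eventually (\<lambda>n. x \<in> space lebesgue - (U n - E)) sequentially"
  proof (rule borel_cantelli_AE1)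
    show fin: "emeasure lebesgue (U n - E) < \<infinity>" for n using U(5)[of n] by (rule less_trans) simp
    have "measure lebesgue (U n - E) \<le> (1/2)^n" for n
      using U(5)[of n] unfolding measure_def by (simp add: enn2real_leI less_imp_le)
    then show "summable (\<lambda>n. measure lebesgue (U n - E))"
      by (intro summable_comparison_test'[OF summable_geometric[of "1/2::real"]]) auto
  qed auto
  then have lim: "AE x in lebesgue. (\<lambda>n. indicat_real (U n) x *\<^sub>R h x) \<longlonglongrightarrow> indicat_real E x *\<^sub>R h x"
  proof eventually_elim
    case (elim x)
    then have "\<forall>\<^sub>F n in sequentially. indicat_real (U n) x *\<^sub>R h x = indicat_real E x *\<^sub>R h x"
      by (rule eventually_mono) (use U(2) in \<open>auto simp: indicator_def\<close>)
    then show ?case by (rule tendsto_eventually)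
  qed
  have "(\<lambda>n. LINT x:U n|lebesgue. h x) \<longlonglongrightarrow> (LINT x:E|lebesgue. h x)"
    unfolding set_lebesgue_integral_def
  proof (rule integral_dominated_convergence[OF _ _ _ lim])
    show "(\<lambda>x. indicat_real E x *\<^sub>R h x) \<in> borel_measurable lebesgue"
      using set_integrable_subset[OF h E] by (auto simp: set_integrable_def)
    show "(\<lambda>x. indicat_real (U n) x *\<^sub>R h x) \<in> borel_measurable lebesgue" for n
      using set_integrable_subset[OF h _ U(3)[of n]] by (auto simp: set_integrable_def)
    show "integrable lebesgue (\<lambda>x. norm (indicat_real {a<..<b} x *\<^sub>R h x))"
      using h unfolding set_integrable_def by (rule integrable_norm)
    show "AE x in lebesgue. norm (indicat_real (U n) x *\<^sub>R h x) \<le> norm (indicat_real {a<..<b} x *\<^sub>R h x)" for n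
      using U(3)[of n] by (intro AE_I2) (auto simp: indicator_def)
  qed
  then show ?thesis by (rule LIMSEQ_le_const2) (use U(4) in auto)
qed

section \<open>Decay of level sets\<close>

lemma set_integral_diff_const:
  fixes f :: "real \<Rightarrow> real"
  assumes "set_integrable lebesgue E f" "E \<in> lmeasurable"
  shows "set_integrable lebesgue E (\<lambda>x. f x - c)"
    and "(LINT x:E|lebesgue. f x - c) = (LINT x:E|lebesgue. f x) - c * measure lebesgue E"
proof -
  have c: "set_integrable lebesgue E (\<lambda>x. c)"
    using integrable_mult_left[of c lebesgue "indicat_real E"] assms(2)
    by (simp add: set_integrable_def lmeasurable_iff_integrable)
  have "(LINT x:E|lebesgue. c) = c * measure lebesgue E"
    using lmeasure_integral[OF assms(2)] integral_mult_left_zero[of lebesgue "indicat_real E" c]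
    by (simp add: set_lebesgue_integral_def)
  then show "set_integrable lebesgue E (\<lambda>x. f x - c)"
    and "(LINT x:E|lebesgue. f x - c) = (LINT x:E|lebesgue. f x) - c * measure lebesgue E"
    using set_integral_diff[OF assms(1) c] by auto
qed

lemma level_set_lmeasurable:
  fixes f :: "real \<Rightarrow> real"
  assumes "set_integrable lebesgue J f" "J \<in> lmeasurable"
  shows "{x \<in> J. r < f x} \<in> lmeasurable"
proof -
  have "(\<lambda>x. indicat_real J x *\<^sub>R f x) \<in> borel_measurable lebesgue"
    using assms(1) by (auto simp: set_integrable_def)
  then have "{x \<in> space lebesgue. r < indicat_real J x *\<^sub>R f x} \<in> sets lebesgue"
    by measurable
  moreover have "{x \<in> J. r < f x} = J \<inter> {x \<in> space lebesgue. r < indicat_real J x *\<^sub>R f x}"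
    by (auto simp: indicator_def)
  ultimately show ?thesis using assms(2) by (simp add: fmeasurable_Int_fmeasurable)
qed

text \<open>The mean of \<open>f\<close> over its level set above \<open>r\<close> is at most \<open>r + N\<close>. Take any \<open>s > r + N\<close>. An interval on
  which the mean of \<open>f\<close> is at least \<open>s\<close> has \<open>f \<ge> s - N > r\<close> almost everywhere, so it lies in the level
  set up to a null set; the mean over \<open>(a, b)\<close> is below \<open>s\<close>. Hence the level set is saturated for
  \<open>f - s\<close>, and the mean of \<open>f\<close> over it is at most \<open>s\<close>.\<close>

lemma level_set_integral_le:
  fixes f :: "real \<Rightarrow> real" and a b N r :: real
  assumes f: "set_integrable lebesgue {a<..<b} f"
    and blo: "\<And>c d. a \<le> c \<Longrightarrow> c < d \<Longrightarrow> d \<le> b \<Longrightarrow>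
        AE x in lebesgue. x \<in> {c<..<d} \<longrightarrow> avg {c<..<d} f - N \<le> f x"
    and ab: "a < b"
    and mean: "avg {a<..<b} f \<le> r + N"
  shows "(LINT x:{x \<in> {a<..<b}. r < f x}|lebesgue. f x - r)
      \<le> N * measure lebesgue {x \<in> {a<..<b}. r < f x}"
proof -
  define E where "E = {x \<in> {a<..<b}. r < f x}"
  have E: "E \<in> lmeasurable" "E \<subseteq> {a<..<b}"
    unfolding E_def using level_set_lmeasurable[OF f] by auto
  have fE: "set_integrable lebesgue E f"
    using E by (intro set_integrable_subset[OF f]) auto
  have pos: "0 < measure lebesgue {c<..<d}" if "c < d" for c d :: real using that by simp
  have le: "(LINT x:E|lebesgue. f x) \<le> s * measure lebesgue E" if s: "r + N < s" for s
  proof -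
    have int: "(LINT x:{c<..<d}|lebesgue. f x - s) = measure lebesgue {c<..<d} * (avg {c<..<d} f - s)"
      if "a \<le> c" "c < d" "d \<le> b" for c d
    proof -
      have "set_integrable lebesgue {c<..<d} f"
        using that by (intro set_integrable_subset[OF f]) auto
      then show ?thesis using pos[OF that(2)] set_integral_diff_const(2)[of "{c<..<d}" f s]
        by (simp add: avg_def algebra_simps)
    qed
    have "(LINT x:E|lebesgue. f x - s) \<le> 0"
    proof (rule set_integral_nonpos_of_saturated)
      show "set_integrable lebesgue {a<..<b} (\<lambda>x. f x - s)"
        using f by (rule set_integral_diff_const) simp
      show "(LINT x:{a<..<b}|lebesgue. f x - s) < 0"
        using int[of a b] ab mean s pos[OF ab] by (simp add: mult_pos_neg)
      fix c d assume cd: "a \<le> c" "c < d" "d \<le> b" "0 \<le> (LINT x:{c<..<d}|lebesgue. f x - s)"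
      then have "s \<le> avg {c<..<d} f"
        using int[of c d] pos[OF cd(2)] by (simp add: zero_le_mult_iff)
      then have "r < avg {c<..<d} f - N" using s by linarith
      with blo[OF cd(1-3)] show "AE x in lebesgue. x \<in> {c<..<d} \<longrightarrow> x \<in> E"
        by (elim eventually_mono) (use cd in \<open>auto simp: E_def\<close>)
    qed (use E in auto)
    then show ?thesis using set_integral_diff_const(2)[OF fE E(1)] by simp
  qed
  have "(LINT x:E|lebesgue. f x - r) \<le> N * measure lebesgue E + e" if "e > 0" for e
  proof -
    define k where "k = measure lebesgue E"
    have "k \<ge> 0" by (simp add: k_def)
    have "(LINT x:E|lebesgue. f x) \<le> (r + N + e / (k + 1)) * k"
      using le[of "r + N + e / (k + 1)"] that \<open>k \<ge> 0\<close> by (fold k_def) simp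
    moreover have "e / (k + 1) * k \<le> e" using that \<open>k \<ge> 0\<close> by (simp add: field_simps)
    ultimately show ?thesis
      using set_integral_diff_const(2)[OF fE E(1), of r] by (simp add: k_def algebra_simps)
  qed
  then show ?thesis unfolding E_def[symmetric] by (rule field_le_epsilon)
qed

text \<open>Let \<open>\<phi> r\<close> be the integral of the positive part of \<open>f - r\<close>. The previous lemma says
  \<open>\<phi> \<le> - N \<phi>'\<close> for \<open>r \<ge> m\<close>, so \<open>\<phi>\<close> decays like \<open>exp (- r / N)\<close>. The measure of a level set is recovered
  from \<open>\<phi>\<close> by Chebyshev's inequality at distance \<open>d\<close> below the level, which costs the factor
  \<open>(N / d) exp (d / N)\<close>; its minimum is at \<open>d = N\<close> and equals \<open>e\<close>. To avoid differentiating \<open>\<phi>\<close>, the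
  decay is proved in \<open>k\<close> equal steps, with \<open>k\<close> tending to infinity.\<close>

lemma level_set_exponential_decay:
  fixes f :: "real \<Rightarrow> real" and a b N m l :: real
  assumes f: "set_integrable lebesgue {a<..<b} f"
    and blo: "\<And>c d. a \<le> c \<Longrightarrow> c < d \<Longrightarrow> d \<le> b \<Longrightarrow>
        AE x in lebesgue. x \<in> {c<..<d} \<longrightarrow> avg {c<..<d} f - N \<le> f x"
    and ab: "a < b"
    and mean: "avg {a<..<b} f \<le> m + N"
    and N: "0 < N"
  shows "measure lebesgue {x \<in> {a<..<b}. m + l < f x} \<le> measure lebesgue {a<..<b} * exp (1 - l / N)"
proof -
  define E where "E r = {x \<in> {a<..<b}. r < f x}" for r
  define \<phi> where "\<phi> r = (LINT x:E r|lebesgue. f x - r)" for r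
  have E: "E r \<in> lmeasurable" for r
    unfolding E_def using level_set_lmeasurable[OF f] by auto
  have fE: "set_integrable lebesgue (E r) f" for r
    using E[of r] by (intro set_integrable_subset[OF f]) (auto simp: E_def)
  have nn: "0 \<le> \<phi> r" for r
    unfolding \<phi>_def set_lebesgue_integral_def
    by (intro integral_nonneg_AE AE_I2) (auto simp: E_def indicator_def)
  have le: "\<phi> r \<le> N * measure lebesgue (E r)" if "m \<le> r" for r
    unfolding \<phi>_def E_def using level_set_integral_le[OF f blo ab, of r] mean that by auto
  have drop: "\<phi> s + (s - r) * measure lebesgue (E s) \<le> \<phi> r" if "r \<le> s" for r s
  proof -
    have "\<phi> s + (s - r) * measure lebesgue (E s) = (LINT x:E s|lebesgue. f x - r)"
      unfolding \<phi>_def set_integral_diff_const(2)[OF fE E] by (simp add: algebra_simps)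
    also have "\<dots> \<le> \<phi> r"
      unfolding \<phi>_def set_lebesgue_integral_def
      using set_integral_diff_const(1)[OF fE E] that
      by (intro integral_mono) (auto simp: set_integrable_def E_def indicator_def)
    finally show ?thesis .
  qed
  have step: "\<phi> (r + d) * (1 + d / N) \<le> \<phi> r" if "m \<le> r" "0 \<le> d" for r d
  proof -
    have "d / N * \<phi> (r + d) \<le> d * measure lebesgue (E (r + d))"
      using mult_left_mono[OF le[of "r + d"], of "d / N"] that N by simp
    then show ?thesis using drop[of r "r + d"] that by (simp add: algebra_simps)
  qed
  have iter: "\<phi> (m + real k * d) * (1 + d / N) ^ k \<le> \<phi> m" if "0 \<le> d" for k d
  proof (induction k)
    case (Suc k)
    have "\<phi> (m + real (Suc k) * d) * (1 + d / N) ^ Suc k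
        = (\<phi> ((m + real k * d) + d) * (1 + d / N)) * (1 + d / N) ^ k"
      by (simp add: algebra_simps)
    also have "\<dots> \<le> \<phi> (m + real k * d) * (1 + d / N) ^ k"
      using step[of "m + real k * d" d] that N by (intro mult_right_mono) auto
    finally show ?case using Suc by linarith
  qed simp
  have decay: "\<phi> (m + t) * exp (t / N) \<le> \<phi> m" if "0 \<le> t" for t
  proof -
    have "(\<lambda>k. (1 + t / N / real k) ^ k) \<longlonglongrightarrow> exp (t / N)"
      by (rule tendsto_exp_limit_sequentially)
    then have "(\<lambda>k. \<phi> (m + t) * (1 + t / N / real k) ^ k) \<longlonglongrightarrow> \<phi> (m + t) * exp (t / N)"
      by (intro tendsto_intros)
    moreover have "\<phi> (m + t) * (1 + t / N / real k) ^ k \<le> \<phi> m" if "1 \<le> k" for k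
      using iter[of "t / real k" k] that \<open>0 \<le> t\<close> by (simp add: mult.commute)
    ultimately show ?thesis by (intro LIMSEQ_le_const2) auto
  qed
  have EI: "measure lebesgue (E r) \<le> measure lebesgue {a<..<b}" for r
    using E[of r] by (intro measure_mono_fmeasurable) (auto simp: E_def)
  show ?thesis
  proof (cases "N \<le> l")
    case True
    have "N * measure lebesgue (E (m + l)) \<le> \<phi> (m + (l - N))"
      using drop[of "m + (l - N)" "m + l"] nn[of "m + l"] N by simp
    then have "N * measure lebesgue (E (m + l)) * exp ((l - N) / N) \<le> \<phi> (m + (l - N)) * exp ((l - N) / N)"
      by (intro mult_right_mono) auto
    also have "\<dots> \<le> \<phi> m" using True by (intro decay) simp
    also have "\<dots> \<le> N * measure lebesgue {a<..<b}"
      using N by (intro order_trans[OF le mult_left_mono[OF EI]]) auto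
    finally have "measure lebesgue (E (m + l)) * exp (l / N - 1) \<le> measure lebesgue {a<..<b}"
      using N by (simp add: mult.assoc diff_divide_distrib)
    then have "measure lebesgue (E (m + l)) \<le> measure lebesgue {a<..<b} / exp (l / N - 1)"
      by (simp add: pos_le_divide_eq)
    then show ?thesis by (simp add: E_def exp_diff field_simps)
  next
    case False
    then have "1 \<le> exp (1 - l / N)" using N by (simp add: field_simps)
    then have "measure lebesgue {a<..<b} * 1 \<le> measure lebesgue {a<..<b} * exp (1 - l / N)"
      by (intro mult_left_mono) auto
    then show ?thesis using EI[of "m + l"] by (simp add: E_def)
  qed
qed

section \<open>The norm and the essential infimum on intervals\<close>

lemma AE_greaterThanLessThan_iff:
  fixes I :: "real set"
  assumes "{a<..<b} \<subseteq> I" "I \<subseteq> {a..b}"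
  shows "AE x in lebesgue. x \<in> I \<longleftrightarrow> x \<in> {a<..<b}"
proof -
  have "AE x in lebesgue. x \<noteq> a" "AE x in lebesgue. x \<noteq> b"
    using AE_completion[OF AE_lborel_singleton] by blast+
  then show ?thesis
  proof eventually_elim
    case (elim x)
    then show ?case using assms by fastforce
  qed
qed

lemma proper_interval_endpoints:
  assumes "proper_interval I"
  obtains a b where "a < b" "{a<..<b} \<subseteq> I" "I \<subseteq> {a..b}" "I \<in> lmeasurable"
    "measure lebesgue I = measure lebesgue {a<..<b}"
proof -
  define a b where "a = Inf I" and "b = Sup I"
  have I: "is_interval I" "bounded I" "0 < measure lebesgue I"
    using assms by (auto simp: proper_interval_def)
  then have ne: "I \<noteq> {}" by auto
  have bd: "bdd_below I" "bdd_above I"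
    using I(2) bounded_imp_bdd_below bounded_imp_bdd_above by auto
  have sub: "{a<..<b} \<subseteq> I"
  proof
    fix x assume "x \<in> {a<..<b}"
    then obtain u v where "u \<in> I" "u < x" "v \<in> I" "x < v"
      using ne bd by (auto simp: a_def b_def cInf_less_iff less_cSup_iff)
    then show "x \<in> I" using mem_is_interval_1_I[OF I(1), of u v x] by auto
  qed
  have sup: "I \<subseteq> {a..b}"
    using bd by (auto simp: a_def b_def intro: cInf_lower cSup_upper)
  have lm: "I \<in> lmeasurable" using I by (intro measurable_convex is_interval_convex)
  have eq: "measure lebesgue I = measure lebesgue {a<..<b}"
    using AE_greaterThanLessThan_iff[OF sub sup] fmeasurableD[OF lm] by (intro measure_eq_AE) auto
  then have "a < b" using I(3) by (cases "a < b") auto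
  then show thesis using that sub sup lm eq by blast
qed

lemma proper_interval_greaterThanLessThan: "c < d \<Longrightarrow> proper_interval {c<..<d}"
  by (auto simp: proper_interval_def is_interval_oo)

lemma le_essinf_iff:
  assumes "set_integrable lebesgue J f" "J \<in> sets lebesgue"
  shows "z \<le> essinf J f \<longleftrightarrow> (AE x in lebesgue. x \<in> J \<longrightarrow> z \<le> ereal (f x))"
proof -
  \<comment> \<open>Measurability matters: the essential supremum of a nonmeasurable function is \<open>top\<close>.\<close>
  have "f \<in> borel_measurable (lebesgue_on J)"
    using assms borel_measurable_integrable
    by (fastforce simp: set_integrable_def borel_measurable_restrict_space_iff)
  then have "(\<lambda>x. - ereal (f x)) \<in> borel_measurable (lebesgue_on J)"
    by measurable
  then have "esssup (lebesgue_on J) (\<lambda>x. - ereal (f x)) \<le> - z \<longleftrightarrow> (AE x in lebesgue_on J. - ereal (f x) \<le> - z)"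
    using esssup_AE[of "\<lambda>x. - ereal (f x)" "lebesgue_on J"]
    by (auto elim: eventually_mono order_trans)
  also have "\<dots> \<longleftrightarrow> (AE x in lebesgue. x \<in> J \<longrightarrow> z \<le> ereal (f x))"
    using assms(2) by (simp add: AE_restrict_space_iff del: uminus_ereal.simps)
  finally show ?thesis unfolding essinf_def by (metis ereal_uminus_le_reorder ereal_uminus_uminus)
qed

lemma greaterThanLessThan_not_null:
  fixes c d :: real
  assumes "AE x in lebesgue. x \<notin> {c<..<d}" shows "d \<le> c"
proof (rule ccontr)
  assume "\<not> d \<le> c"
  have "emeasure lebesgue {c<..<d} = 0"
    using assms by (subst (asm) AE_iff_measurable[of "{c<..<d}"]) auto
  then show False using \<open>\<not> d \<le> c\<close> by simp
qed

text \<open>In this form, as a pointwise lower bound valid almost everywhere, the norm no longer involves the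
  extended-real essential infimum.\<close>

lemma avg_sub_le_of_BLO_norm_le:
  assumes f: "set_integrable lebesgue I0 f" and N: "BLO_norm I0 f \<le> ereal N"
    and J: "J \<in> subintervals I0"
  shows "AE x in lebesgue. x \<in> J \<longrightarrow> avg J f - N \<le> f x"
proof -
  have JI: "proper_interval J" "J \<subseteq> I0" using J by (auto simp: subintervals_def)
  then have Js: "J \<in> sets lebesgue" by (meson proper_interval_endpoints fmeasurableD)
  have "ereal (avg J f) - essinf J f \<le> BLO_norm I0 f"
    unfolding BLO_norm_def using J by (rule SUP_upper)
  then have "ereal (avg J f) - essinf J f \<le> ereal N" using N by (rule order_trans)
  then have "ereal (avg J f - N) \<le> essinf J f" by (cases "essinf J f") auto
  then show ?thesis
    using le_essinf_iff[OF set_integrable_subset[OF f Js JI(2)] Js, of "ereal (avg J f - N)"] by simp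
qed

lemma BLO_norm_leI:
  assumes f: "set_integrable lebesgue I0 f"
    and le: "\<And>J. J \<in> subintervals I0 \<Longrightarrow> AE x in lebesgue. x \<in> J \<longrightarrow> avg J f - N \<le> f x"
  shows "BLO_norm I0 f \<le> ereal N"
  unfolding BLO_norm_def
proof (rule SUP_least)
  fix J assume J: "J \<in> subintervals I0"
  have JI: "proper_interval J" "J \<subseteq> I0" using J by (auto simp: subintervals_def)
  then have Js: "J \<in> sets lebesgue" by (meson proper_interval_endpoints fmeasurableD)
  have "ereal (avg J f - N) \<le> essinf J f"
    using le_essinf_iff[OF set_integrable_subset[OF f Js JI(2)] Js, of "ereal (avg J f - N)"] le[OF J] by simp
  then show "ereal (avg J f) - essinf J f \<le> ereal N" by (cases "essinf J f") auto
qed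

lemma avg_greaterThanLessThan:
  assumes "{a<..<b} \<subseteq> I" "I \<subseteq> {a..b}" "I \<in> sets lebesgue" "set_integrable lebesgue I f"
    "measure lebesgue I = measure lebesgue {a<..<b}"
  shows "avg I f = avg {a<..<b} f"
proof -
  have "(LINT x:{a<..<b}|lebesgue. f x) = (LINT x:I|lebesgue. f x)"
  proof (rule set_integral_cong_set)
    show "set_borel_measurable lebesgue I f" "set_borel_measurable lebesgue {a<..<b} f"
      using assms set_integrable_subset[OF assms(4), of "{a<..<b}"]
      by (auto simp: set_borel_measurable_def set_integrable_def)
  qed (use AE_greaterThanLessThan_iff[OF assms(1,2)] in auto)
  then show ?thesis using assms(5) by (simp add: avg_def)
qed

lemma essinf_real:
  assumes f: "f \<in> BLO I0" and I: "I \<in> subintervals I0"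
  obtains m where "essinf I f = ereal m" "m \<le> avg I f"
proof -
  have fI0: "set_integrable lebesgue I0 f" using f by (simp add: BLO_def)
  have I': "proper_interval I" "I \<subseteq> I0" using I by (auto simp: subintervals_def)
  then obtain a b where ab: "a < b" "{a<..<b} \<subseteq> I" "I \<subseteq> {a..b}" "I \<in> lmeasurable"
    "measure lebesgue I = measure lebesgue {a<..<b}" by (meson proper_interval_endpoints)
  have Is: "I \<in> sets lebesgue" using ab by auto
  have fI: "set_integrable lebesgue I f" using fI0 Is I'(2) by (rule set_integrable_subset)
  have "ereal (avg I f) - essinf I f \<le> BLO_norm I0 f"
    unfolding BLO_norm_def using I by (rule SUP_upper)
  also have "\<dots> < \<infinity>" using f by (simp add: BLO_def)
  finally have "essinf I f \<noteq> -\<infinity>" by auto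
  moreover have "essinf I f \<noteq> \<infinity>"
  proof
    assume "essinf I f = \<infinity>"
    then have "AE x in lebesgue. x \<in> I \<longrightarrow> \<infinity> \<le> ereal (f x)"
      using le_essinf_iff[OF fI Is, of \<infinity>] by simp
    then have "AE x in lebesgue. x \<notin> {a<..<b}"
      by (rule eventually_mono) (use ab(2) in auto)
    then show False using greaterThanLessThan_not_null ab(1) by fastforce
  qed
  ultimately obtain m where m: "essinf I f = ereal m" by (cases "essinf I f") auto
  then have ae: "AE x in lebesgue. x \<in> I \<longrightarrow> m \<le> f x"
    using le_essinf_iff[OF fI Is, of "ereal m"] by simp
  have "0 \<le> (LINT x:I|lebesgue. f x - m)"
    unfolding set_lebesgue_integral_def using ae
    by (intro integral_nonneg_AE) (auto elim!: eventually_mono simp: indicator_def)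
  then have "m * measure lebesgue I \<le> (LINT x:I|lebesgue. f x)"
    using set_integral_diff_const(2)[OF fI ab(4)] by simp
  then have "m \<le> avg I f"
    using I'(1) by (simp add: avg_def proper_interval_def pos_le_divide_eq)
  with m that show thesis by blast
qed

lemma BLO_norm_real:
  assumes "proper_interval I0" "f \<in> BLO I0"
  obtains N where "BLO_norm I0 f = ereal N" "0 \<le> N"
proof -
  have I0: "I0 \<in> subintervals I0" using assms by (simp add: subintervals_def)
  obtain m where m: "essinf I0 f = ereal m" "m \<le> avg I0 f" using essinf_real[OF assms(2) I0] .
  have "0 \<le> ereal (avg I0 f) - essinf I0 f" using m by simp
  also have "\<dots> \<le> BLO_norm I0 f" unfolding BLO_norm_def using I0 by (rule SUP_upper)
  finally have "0 \<le> BLO_norm I0 f" .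
  moreover have "BLO_norm I0 f < \<infinity>" using assms(2) by (simp add: BLO_def)
  ultimately show thesis using that by (cases "BLO_norm I0 f") auto
qed

section \<open>The upper bound\<close>

lemma upper_fraction_le_1:
  assumes f: "f \<in> BLO I0" and I: "I \<in> subintervals I0"
  shows "upper_fraction I f l \<le> 1"
proof -
  have I': "proper_interval I" "I \<subseteq> I0" using I by (auto simp: subintervals_def)
  then have lm: "I \<in> lmeasurable" by (meson proper_interval_endpoints)
  have "set_integrable lebesgue I0 f" using f by (simp add: BLO_def)
  then have fI: "set_integrable lebesgue I f"
    using fmeasurableD[OF lm] I'(2) by (rule set_integrable_subset)
  obtain m where m: "essinf I f = ereal m" using essinf_real[OF f I] .
  have eq: "{x \<in> I. ereal (f x) - essinf I f > ereal l} = {x \<in> I. m + l < f x}"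
    by (auto simp: m)
  have "measure lebesgue {x \<in> I. m + l < f x} \<le> measure lebesgue I"
    using level_set_lmeasurable[OF fI lm] lm by (intro measure_mono_fmeasurable) auto
  then show ?thesis
    using I'(1) by (simp add: upper_fraction_def proper_interval_def eq)
qed

lemma upper_fraction_le_exp:
  assumes f: "f \<in> BLO I0" and I: "I \<in> subintervals I0"
    and N: "BLO_norm I0 f \<le> ereal N" "0 < N"
  shows "upper_fraction I f l \<le> exp (1 - l / N)"
proof -
  have fI0: "set_integrable lebesgue I0 f" using f by (simp add: BLO_def)
  have I': "proper_interval I" "I \<subseteq> I0" using I by (auto simp: subintervals_def)
  then obtain a b where ab: "a < b" "{a<..<b} \<subseteq> I" "I \<subseteq> {a..b}" "I \<in> lmeasurable"
    "measure lebesgue I = measure lebesgue {a<..<b}" by (meson proper_interval_endpoints)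
  have Is: "I \<in> sets lebesgue" using ab by auto
  have fI: "set_integrable lebesgue I f" using fI0 Is I'(2) by (rule set_integrable_subset)
  have fab: "set_integrable lebesgue {a<..<b} f" using fI _ ab(2) by (rule set_integrable_subset) simp
  obtain m where m: "essinf I f = ereal m" using essinf_real[OF f I] .
  have "ereal (avg I f) - essinf I f \<le> BLO_norm I0 f"
    unfolding BLO_norm_def using I by (rule SUP_upper)
  also note N(1)
  finally have mean: "avg I f \<le> m + N" by (simp add: m)
  have eq: "{x \<in> I. ereal (f x) - essinf I f > ereal l} = {x \<in> I. m + l < f x}"
    by (auto simp: m)
  have "measure lebesgue {x \<in> I. m + l < f x} = measure lebesgue {x \<in> {a<..<b}. m + l < f x}"
    using AE_greaterThanLessThan_iff[OF ab(2,3)]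
      level_set_lmeasurable[OF fI ab(4)] level_set_lmeasurable[OF fab]
    by (intro measure_eq_AE) (auto elim!: eventually_mono)
  also have "\<dots> \<le> measure lebesgue {a<..<b} * exp (1 - l / N)"
  proof (rule level_set_exponential_decay[OF fab _ ab(1) _ N(2)])
    show "avg {a<..<b} f \<le> m + N"
      using mean avg_greaterThanLessThan[OF ab(2,3) Is fI ab(5)] by simp
    fix c d :: real assume cd: "a \<le> c" "c < d" "d \<le> b"
    have "{c<..<d} \<subseteq> {a<..<b}" using cd by auto
    then have "{c<..<d} \<in> subintervals I0"
      using proper_interval_greaterThanLessThan[OF cd(2)] ab(2) I'(2) by (auto simp: subintervals_def)
    then show "AE x in lebesgue. x \<in> {c<..<d} \<longrightarrow> avg {c<..<d} f - N \<le> f x"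
      by (rule avg_sub_le_of_BLO_norm_le[OF fI0 N(1)])
  qed
  finally show ?thesis
    using ab(1) by (simp add: upper_fraction_def eq ab(5) divide_le_eq mult.commute)
qed

text \<open>When the norm vanishes, the preceding bound holds for every positive \<open>N\<close>, and it tends to \<open>0\<close> with \<open>N\<close>.\<close>

lemma upper_fraction_le_BLO_exp:
  assumes "proper_interval I0" and f: "f \<in> BLO I0" and I: "I \<in> subintervals I0" and l: "0 < l"
  shows "upper_fraction I f l \<le> BLO_exp I0 f 1 l"
proof -
  obtain N where N: "BLO_norm I0 f = ereal N" "0 \<le> N" using BLO_norm_real[OF assms(1,2)] .
  show ?thesis
  proof (cases "N = 0")
    case False
    then show ?thesis using upper_fraction_le_exp[OF f I, of N l] N by (simp add: BLO_exp_def)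
  next
    case True
    have "upper_fraction I f l \<le> 0"
    proof (rule ccontr)
      define u where "u = upper_fraction I f l"
      assume "\<not> upper_fraction I f l \<le> 0"
      then have u: "0 < u" by (simp add: u_def)
      \<comment> \<open>Chosen so that the bound for \<open>N = 1 / k\<close> is below \<open>u\<close>.\<close>
      define k where "k = \<bar>1 - ln u\<bar> / l + 1"
      have k: "0 < k" "\<bar>1 - ln u\<bar> < l * k" using l by (auto simp: k_def field_simps add_nonneg_pos)
      have "u \<le> exp (1 - l / (1 / k))"
        unfolding u_def using upper_fraction_le_exp[OF f I, of "1 / k" l] N True k by simp
      also have "\<dots> < exp (ln u)" using k by simp
      finally show False using u by simp
    qed
    then show ?thesis using N True by (simp add: BLO_exp_def)
  qed
qed

lemma John_Nirenberg_exp_1: "John_Nirenberg (exp 1) 1"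
  unfolding John_Nirenberg_def
proof (intro allI impI)
  fix I0 f and l :: real
  assume "proper_interval I0" "f \<in> BLO I0" "0 < l"
  have "(SUP I\<in>subintervals I0. upper_fraction I f l) \<le> BLO_exp I0 f 1 l"
    by (rule cSUP_least) (use \<open>proper_interval I0\<close> \<open>f \<in> BLO I0\<close> \<open>0 < l\<close>
        in \<open>auto simp: subintervals_def intro!: upper_fraction_le_BLO_exp\<close>)
  also have "\<dots> = exp 1 * BLO_exp I0 f 0 (1 * l)"
    by (simp add: BLO_exp_def exp_diff exp_minus field_simps)
  finally show "(SUP I\<in>subintervals I0. upper_fraction I f l) \<le> exp 1 * BLO_exp I0 f 0 (1 * l)" .
qed

section \<open>Sharpness\<close>

text \<open>The extremal functions on \<open>(0, 1)\<close>: on \<open>(0, t)\<close> the function \<open>- ln x\<close> is replaced by its mean over that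
  interval. For \<open>d \<ge> t\<close> this does not change the mean over \<open>(0, d)\<close>, which is \<open>1 - ln d\<close>, so the norm
  stays at most \<open>1\<close>, while the level set above any level just below \<open>1 - ln t\<close> grows to \<open>(0, t)\<close>.\<close>

definition truncated_log :: "real \<Rightarrow> real \<Rightarrow> real" where
  "truncated_log t x = (if x < t then 1 - ln t else - ln x)"

lemma truncated_log_has_integral:
  assumes t: "0 < t" and cd: "0 \<le> c" "c \<le> d"
  defines "G \<equiv> \<lambda>x. if x \<le> t then x - x * ln t else x - x * ln x"
  shows "(truncated_log t has_integral (G d - G c)) {c..d}"
proof (rule fundamental_theorem_of_calculus_interior_strong[where S = "{t}"])
  have "continuous_on ({c..t} \<union> {t..d}) G"
    unfolding G_def using t by (intro continuous_on_cases continuous_intros) auto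
  then show "continuous_on {c..d} G" by (rule continuous_on_subset) auto
  fix x assume x: "x \<in> {c<..<d} - {t}"
  show "(G has_vector_derivative truncated_log t x) (at x)"
  proof (cases "x < t")
    case True
    have "((\<lambda>x. x - x * ln t) has_real_derivative 1 - ln t) (at x)"
      by (auto intro!: derivative_eq_intros)
    then have "(G has_real_derivative 1 - ln t) (at x)"
      by (rule has_field_derivative_transform_within_open[where S = "{..<t}"])
        (use True in \<open>auto simp: G_def\<close>)
    then show ?thesis
      using True by (simp add: truncated_log_def has_real_derivative_iff_has_vector_derivative)
  next
    case False
    then have "t < x" using x by auto
    then have "((\<lambda>x. x - x * ln x) has_real_derivative - ln x) (at x)"
      using t by (auto intro!: derivative_eq_intros)
    then have "(G has_real_derivative - ln x) (at x)"
      by (rule has_field_derivative_transform_within_open[where S = "{t<..}"])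
        (use \<open>t < x\<close> in \<open>auto simp: G_def\<close>)
    then show ?thesis
      using False by (simp add: truncated_log_def has_real_derivative_iff_has_vector_derivative)
  qed
qed (use cd in auto)

lemma truncated_log_nonneg: "0 < t \<Longrightarrow> t < 1 \<Longrightarrow> x \<le> 1 \<Longrightarrow> 0 \<le> truncated_log t x"
  by (auto simp: truncated_log_def intro: order_trans[OF ln_le_zero_iff[THEN iffD2]])

lemma truncated_log_integrable:
  assumes "0 < t" "t < 1"
  shows "set_integrable lebesgue {0<..<1} (truncated_log t)"
proof -
  have "truncated_log t absolutely_integrable_on {0..1}"
    using truncated_log_has_integral[of t 0 1] truncated_log_nonneg[of t] assms
    by (intro nonnegative_absolutely_integrable_1) (auto intro: has_integral_integrable)
  then show ?thesis by (rule set_integrable_subset) auto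
qed

text \<open>For \<open>d \<ge> t\<close> the function is at least \<open>- ln d\<close> on \<open>(c, d)\<close>. Since it is decreasing, its mean over \<open>(c, d)\<close>
  is at most its mean over \<open>(0, d)\<close>, which is \<open>1 - ln d\<close>. For \<open>d < t\<close> it is constant on the interval.\<close>

lemma truncated_log_ge_avg:
  assumes t: "0 < t" "t < 1" and cd: "0 \<le> c" "c < d" "d \<le> 1" and x: "x \<in> {c<..<d}"
  shows "avg {c<..<d} (truncated_log t) - 1 \<le> truncated_log t x"
proof -
  define G where "G \<equiv> \<lambda>x. if x \<le> t then x - x * ln t else x - x * ln x"
  have "set_integrable lebesgue {c<..<d} (truncated_log t)"
    using truncated_log_integrable[OF t] by (rule set_integrable_subset) (use cd in auto)
  then have "(LINT x:{c<..<d}|lebesgue. truncated_log t x) = integral {c..d} (truncated_log t)"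
    by (simp add: set_lebesgue_integral_eq_integral integral_open_interval_real)
  also have "\<dots> = G d - G c"
    using truncated_log_has_integral[OF t(1) cd(1), of d] cd(2) by (simp add: G_def integral_unique)
  finally have avg: "avg {c<..<d} (truncated_log t) = (G d - G c) / (d - c)"
    using cd by (simp add: avg_def)
  show ?thesis
  proof (cases "d < t")
    case True
    then have "G d - G c = (1 - ln t) * (d - c)" using cd by (simp add: G_def algebra_simps)
    then have "avg {c<..<d} (truncated_log t) = 1 - ln t" using avg cd by simp
    then show ?thesis using True x by (simp add: truncated_log_def)
  next
    case False
    have "c * ln (max c t) \<le> c * ln d"
      using False cd t by (intro mult_left_mono) auto
    then have "G d - G c \<le> (1 - ln d) * (d - c)"
      using False cd by (auto simp: G_def algebra_simps max_def split: if_splits)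
    then have "avg {c<..<d} (truncated_log t) \<le> 1 - ln d"
      using avg cd by (simp add: divide_le_eq)
    moreover have "- ln d \<le> truncated_log t x"
    proof (cases "x < t")
      case True
      then have "ln t \<le> ln d" using False t by auto
      then show ?thesis using True by (simp add: truncated_log_def)
    next
      case False
      then have "ln x \<le> ln d" using x t by auto
      then show ?thesis using False by (simp add: truncated_log_def)
    qed
    ultimately show ?thesis by linarith
  qed
qed

lemma BLO_norm_truncated_log:
  assumes t: "0 < t" "t < 1"
  shows "BLO_norm {0<..<1} (truncated_log t) \<le> ereal 1"
proof (rule BLO_norm_leI[OF truncated_log_integrable[OF t]])
  fix J assume "J \<in> subintervals {0<..<1::real}"
  then have J: "proper_interval J" "J \<subseteq> {0<..<1}" by (auto simp: subintervals_def)
  then obtain c d where cd: "c < d" "{c<..<d} \<subseteq> J" "J \<subseteq> {c..d}" "J \<in> lmeasurable"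
    "measure lebesgue J = measure lebesgue {c<..<d}" by (meson proper_interval_endpoints)
  have "{c<..<d} \<subseteq> {0<..<1}" using cd J by auto
  then have le: "0 \<le> c" "d \<le> 1" using cd(1) by (auto simp: greaterThanLessThan_subseteq_greaterThanLessThan)
  have "set_integrable lebesgue J (truncated_log t)"
    using truncated_log_integrable[OF t] fmeasurableD[OF cd(4)] J(2) by (rule set_integrable_subset)
  then have "avg J (truncated_log t) = avg {c<..<d} (truncated_log t)"
    using avg_greaterThanLessThan cd fmeasurableD by blast
  with AE_greaterThanLessThan_iff[OF cd(2,3)]
  show "AE x in lebesgue. x \<in> J \<longrightarrow> avg J (truncated_log t) - 1 \<le> truncated_log t x"
    by (elim eventually_mono) (use truncated_log_ge_avg[OF t le(1) cd(1) le(2)] in auto)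
qed

lemma truncated_log_BLO: "0 < t \<Longrightarrow> t < 1 \<Longrightarrow> truncated_log t \<in> BLO {0<..<1}"
  using truncated_log_integrable BLO_norm_truncated_log[of t]
  by (auto simp: BLO_def intro: le_less_trans)

lemma essinf_truncated_log:
  assumes t: "0 < t" "t < 1"
  shows "essinf {0<..<1} (truncated_log t) = 0"
proof (rule antisym)
  note iff = le_essinf_iff[OF truncated_log_integrable[OF t]]
  show "0 \<le> essinf {0<..<1} (truncated_log t)"
    using truncated_log_nonneg[OF t] by (subst iff) auto
  show "essinf {0<..<1} (truncated_log t) \<le> 0"
  proof (rule ccontr)
    assume "\<not> ?thesis"
    then obtain e where e: "0 < e" "ereal e < essinf {0<..<1} (truncated_log t)"
      using ereal_dense2[of 0 "essinf {0<..<1} (truncated_log t)"] by (auto simp: not_le)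
    then have ae: "AE x in lebesgue. x \<in> {0<..<1} \<longrightarrow> ereal e \<le> ereal (truncated_log t x)"
      by (subst iff[symmetric]) auto
    have lt: "truncated_log t x < e" if "x \<in> {max t (exp (- e))<..<1}" for x
    proof -
      have "exp (- e) < x" "t < x" using that by auto
      then have "ln (exp (- e)) < ln x" using t by (subst ln_less_cancel_iff) auto
      then show ?thesis using \<open>t < x\<close> by (simp add: truncated_log_def)
    qed
    have "AE x in lebesgue. x \<notin> {max t (exp (- e))<..<1}"
      using ae
    proof eventually_elim
      case (elim x)
      then show ?case using lt[of x] t by fastforce
    qed
    then have "1 \<le> max t (exp (- e))" by (rule greaterThanLessThan_not_null)
    then show False using t e by (simp add: le_max_iff_disj)
  qed
qed

lemma upper_fraction_truncated_log:
  assumes t: "0 < t" "t < 1" and l: "l < 1 - ln t"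
  shows "t \<le> upper_fraction {0<..<1} (truncated_log t) l"
proof -
  have eq: "{x \<in> {0<..<1}. ereal (truncated_log t x) - essinf {0<..<1} (truncated_log t) > ereal l}
      = {x \<in> {0<..<1}. l < truncated_log t x}"
    by (simp add: essinf_truncated_log[OF t])
  have "t = measure lebesgue {0<..<t}" using t by simp
  also have "\<dots> \<le> measure lebesgue {x \<in> {0<..<1}. l < truncated_log t x}"
    using t l level_set_lmeasurable[OF truncated_log_integrable[OF t], of l]
    by (intro measure_mono_fmeasurable) (auto simp: truncated_log_def)
  finally show ?thesis unfolding upper_fraction_def eq by simp
qed

text \<open>The function truncated at \<open>t = exp (1 - s)\<close> is larger than every \<open>l < s\<close> on \<open>(0, t)\<close>. Letting \<open>l\<close> tend to
  \<open>s\<close> gives \<open>exp (1 - s) \<le> c1 * exp (- c2 * s)\<close>. For \<open>c2 = 1\<close> this reads \<open>e \<le> c1\<close>, and for \<open>c2 > 1\<close> it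
  fails for large \<open>s\<close>.\<close>

lemma John_Nirenberg_lower_bound:
  assumes JN: "John_Nirenberg c1 c2" and c: "0 < c1" "0 < c2" and s: "1 < s"
  shows "exp (1 + (c2 - 1) * s) \<le> c1"
proof -
  define t where "t = exp (1 - s)"
  have t: "0 < t" "t < 1" "1 - ln t = s" using s by (auto simp: t_def)
  define I :: "real set" where "I = {0<..<1}"
  have I: "proper_interval I" "I \<in> subintervals I"
    using proper_interval_greaterThanLessThan[of 0 1] by (auto simp: I_def subintervals_def)
  have f: "truncated_log t \<in> BLO I" unfolding I_def using t by (intro truncated_log_BLO)
  obtain N where N: "BLO_norm I (truncated_log t) = ereal N" "0 \<le> N" using BLO_norm_real[OF I(1) f] .
  then have "N \<le> 1" using BLO_norm_truncated_log[OF t(1,2)] by (simp add: I_def)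
  have le: "t \<le> c1 * exp (- (c2 * l))" if l: "0 < l" "l < s" for l
  proof -
    have "t \<le> upper_fraction I (truncated_log t) l"
      unfolding I_def using t l by (intro upper_fraction_truncated_log) auto
    also have "\<dots> \<le> (SUP J\<in>subintervals I. upper_fraction J (truncated_log t) l)"
      using I(2) upper_fraction_le_1[OF f] by (intro cSUP_upper) (auto simp: bdd_above_def)
    also have "\<dots> \<le> c1 * BLO_exp I (truncated_log t) 0 (c2 * l)"
      using JN I(1) f l(1) by (simp add: John_Nirenberg_def)
    also have "\<dots> \<le> c1 * exp (- (c2 * l))"
    proof (rule mult_left_mono)
      have "c2 * l \<le> c2 * l / N" if "N \<noteq> 0"
        using that N(2) \<open>N \<le> 1\<close> c l by (simp add: pos_le_divide_eq mult_left_le)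
      then show "BLO_exp I (truncated_log t) 0 (c2 * l) \<le> exp (- (c2 * l))"
        by (auto simp: BLO_exp_def N)
    qed (use c in simp)
    finally show ?thesis .
  qed
  have "((\<lambda>l. c1 * exp (- (c2 * l))) \<longlongrightarrow> c1 * exp (- (c2 * s))) (at_left s)"
    by (intro tendsto_intros)
  moreover have "\<forall>\<^sub>F l in at_left s. t \<le> c1 * exp (- (c2 * l))"
    using eventually_at_left_real[of 0 s] s by (auto elim!: eventually_mono intro!: le)
  ultimately have "t \<le> c1 * exp (- (c2 * s))"
    by (intro tendsto_lowerbound) auto
  then have "exp (1 - s) * exp (c2 * s) \<le> c1 * exp (- (c2 * s)) * exp (c2 * s)"
    unfolding t_def by (intro mult_right_mono) auto
  then show ?thesis by (simp add: mult.assoc flip: exp_add) (simp add: algebra_simps)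
qed

lemma c2_star_eq_1: "c2_star = 1"
proof (rule antisym)
  have "1 \<in> {c2. 0 < c2 \<and> (\<exists>c1>0. John_Nirenberg c1 c2)}"
    by (auto intro!: exI[of _ "exp 1"] John_Nirenberg_exp_1)
  then have "ereal 1 \<in> ereal ` {c2. 0 < c2 \<and> (\<exists>c1>0. John_Nirenberg c1 c2)}" by (rule imageI)
  then show "1 \<le> c2_star" unfolding c2_star_def one_ereal_def by (rule Sup_upper)
  show "c2_star \<le> 1"
    unfolding c2_star_def
  proof (rule Sup_least)
    fix z assume "z \<in> ereal ` {c2. 0 < c2 \<and> (\<exists>c1>0. John_Nirenberg c1 c2)}"
    then obtain c1 c2 where c: "0 < c2" "0 < c1" "John_Nirenberg c1 c2" "z = ereal c2" by auto
    have "c2 \<le> 1"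
    proof (rule ccontr)
      assume gt: "\<not> c2 \<le> 1"
      \<comment> \<open>Makes the exponent \<open>1 + (c2 - 1) * s\<close> exceed \<open>c1\<close>, and \<open>exp y > y\<close>.\<close>
      define s where "s = c1 / (c2 - 1) + 2"
      have "1 < s" using c gt by (simp add: s_def add_pos_pos)
      then have "exp (1 + (c2 - 1) * s) \<le> c1"
        using John_Nirenberg_lower_bound c by blast
      moreover have "1 + (c2 - 1) * s = 1 + c1 + 2 * (c2 - 1)" using gt by (simp add: s_def field_simps)
      ultimately have "exp (1 + c1 + 2 * (c2 - 1)) \<le> c1" by (simp only:)
      moreover have "c1 < 1 + c1 + 2 * (c2 - 1)" using gt by simp
      moreover have "y < exp y" for y :: real using exp_ge_add_one_self[of y] by linarith
      ultimately show False by (meson less_trans not_le)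
    qed
    then show "z \<le> 1" using c by simp
  qed
qed

theorem theorem1p1:
  shows "is_c1_star (exp 1) \<and> c2_star = 1 \<and>
    (\<forall>I0 f I l. proper_interval I0 \<longrightarrow> f \<in> BLO I0 \<longrightarrow> I \<in> subintervals I0 \<longrightarrow> 0 < l \<longrightarrow>
       upper_fraction I f l \<le> min 1 (BLO_exp I0 f 1 l))"
proof (intro conjI allI impI)
  show "is_c1_star (exp 1)"
    unfolding is_c1_star_def c2_star_eq_1
    using John_Nirenberg_exp_1 John_Nirenberg_lower_bound[of _ 1 2] by auto
  show "c2_star = 1" by (rule c2_star_eq_1)
  fix I0 f I and l :: real
  assume "proper_interval I0" "f \<in> BLO I0" "I \<in> subintervals I0" "0 < l"
  then show "upper_fraction I f l \<le> min 1 (BLO_exp I0 f 1 l)"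
    using upper_fraction_le_1 upper_fraction_le_BLO_exp by simp
qed

end
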